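(* Let $M>1$ and $R>0$, and let $\{\Omega_i\}$ be a sequence of $M$-uniform domains in $B_R\subset\mathbb{R}^n$ such that $$\inf_i \operatorname{diam}(\Omega_i)>0 .$$ Then there exists an $M$-uniform domain $\Omega$ such that, after passing to a subsequence, $\Omega_i\to\Omega$ in $L^1$ as $i\to\infty$.
   Context: $B_R$ is the ball of radius $R$ in $\mathbb{R}^n$ centered at the origin. A domain is a (nonempty) connected open set. For $M>1$, a domain $\Omega\subset\mathbb{R}^n$ is called an $M$-uniform domain if for any $x_1,x_2\in\overline{\Omega}$ there is a rectifiable curve $\gamma:[0,1]\to\overline{\Omega}$ with $\gamma(0)=x_1$, $\gamma(1)=x_2$, such that (i) $\mathscr{H}^1(\gamma)\le M|x_1-x_2|$ and (ii) $d(\gamma(t),\partial\Omega)\ge \frac1M\min\{|\gamma(t)-x_1|,|\gamma(t)-x_2|\}$ for all $t\in[0,1]$. Here $\mathscr{H}^1$ is one-dimensional Hausdorff measure and $d$ is Euclidean distance. Convergence $\Omega_i\to\Omega$ in $L^1$ means that the characteristic functions converge in $L^1$, i.e. $|\Omega_i\Delta\Omega|\to0$, where $|\cdot|$ is Lebesgue measure. The domains are not assumed to have finite perimeter. *)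

theory Defs
  imports "HOL-Analysis.Analysis"
begin

(* Boundedness is required because the library's diameter is a real supremum, hence
   meaningless on unbounded sets.  Since the diameter of the empty set is 0, the sequences U
   also account for finite coverings.  *)
definition hausdorff1_pre :: "real \<Rightarrow> 'a::metric_space set \<Rightarrow> ennreal" where
  "hausdorff1_pre \<delta> A =
     (INF U \<in> {U :: nat \<Rightarrow> 'a set. A \<subseteq> (\<Union>j. U j) \<and> (\<forall>j. bounded (U j) \<and> diameter (U j) \<le> \<delta>)}.
        (\<Sum>j. ennreal (diameter (U j))))"

(* One-dimensional Hausdorff measure, normalised so that a segment has measure its length. *)
definition hausdorff1 :: "'a::metric_space set \<Rightarrow> ennreal" where
  "hausdorff1 A = (SUP \<delta> \<in> {0<..}. hausdorff1_pre \<delta> A)"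

(* Supremum of the lengths of the inscribed polygons; repeated nodes are harmless. *)
definition curve_length :: "(real \<Rightarrow> 'a::metric_space) \<Rightarrow> ennreal" where
  "curve_length \<gamma> =
     (SUP (m, s) \<in> {(m :: nat, s :: nat \<Rightarrow> real). mono s \<and> range s \<subseteq> {0..1}}.
        (\<Sum>k<m. ennreal (dist (\<gamma> (s k)) (\<gamma> (s (Suc k))))))"

definition rectifiable_curve :: "(real \<Rightarrow> 'a::metric_space) \<Rightarrow> bool" where
  "rectifiable_curve \<gamma> \<longleftrightarrow> path \<gamma> \<and> curve_length \<gamma> < \<infinity>"

definition is_domain :: "'a::topological_space set \<Rightarrow> bool" where
  "is_domain S \<longleftrightarrow> S \<noteq> {} \<and> open S \<and> connected S"

(* The frontier is empty only for the whole space, where the distance to it is infinite by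
   convention and the last condition is void; the library's infdist would give 0 instead. *)
definition uniform_domain :: "real \<Rightarrow> (real ^ 'n) set \<Rightarrow> bool" where
  "uniform_domain M S \<longleftrightarrow>
     is_domain S \<and>
     (\<forall>x1 \<in> closure S. \<forall>x2 \<in> closure S. \<exists>\<gamma>.
        rectifiable_curve \<gamma> \<and> path_image \<gamma> \<subseteq> closure S \<and> \<gamma> 0 = x1 \<and> \<gamma> 1 = x2 \<and>
        hausdorff1 (path_image \<gamma>) \<le> ennreal (M * dist x1 x2) \<and>
        (\<forall>t \<in> {0..1}. frontier S \<noteq> {} \<longrightarrow>
           infdist (\<gamma> t) (frontier S) \<ge> 1 / M * min (dist (\<gamma> t) x1) (dist (\<gamma> t) x2)))"

end

theory Submission
  imports Defs "HOL-Complex_Analysis.Great_Picard"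
begin

text \<open>The functions \<open>x \<mapsto> infdist x (- \<Omega> i)\<close> are uniformly bounded and
1-Lipschitz, so a subsequence converges pointwise to a 1-Lipschitz function \<open>f\<close>,
and \<open>{x. f x > 0}\<close> is the natural candidate for the limit domain. Two features of
uniform domains make it work.

First, the curve joining a point \<open>x\<close> of the closure to a point at distance at least
\<open>2 * r\<close> crosses the sphere of radius \<open>r\<close> about \<open>x\<close>, and
the crossing point is the centre of a ball of radius \<open>r / M\<close> inside the domain
(\<open>uniform_domain_corkscrew\<close>). Because the diameters are bounded below, such balls
exist at all small scales, with constants independent of \<open>i\<close>. They survive in the
limit, so that limits of points of the \<open>\<Omega> i\<close> lie in the closure of the limit
domain (\<open>limit_in_closure\<close>). Hence a point that belongs to infinitely many of the
symmetric differences is a frontier point of the limit domain. The same balls show that the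
frontier is porous, hence null (\<open>negligible_frontier_uniform_domain\<close>), and
convergence in measure follows.

Secondly, the joining curves must pass to the limit with the same constant \<open>M\<close>.
Their parametrisations are uncontrolled and the curves may retrace themselves, so a curve is
first replaced by an arc inside its image. For an arc, inscribed polygons are no longer than the
Hausdorff measure of the image (\<open>arc_polygon_le_hausdorff1\<close>). Following the
vertices of a fine polygon at constant speed gives a step function which is Lipschitz up to an
arbitrarily small error, with the Hausdorff measure as constant
(\<open>path_discretization\<close>). Such step functions have a pointwise convergent
subsequence whose limit is genuinely Lipschitz, and a Lipschitz curve on the unit interval has
Hausdorff measure at most its Lipschitz constant.

The distance condition is closed under these limits because it says that certain balls lie in
the domain (\<open>uniform_domain_iff_balls\<close>), which is a lower bound for \<open>infdist
x (- \<Omega> i)\<close>. It also yields connectedness of the limit: a limit curve between two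
points of the open set \<open>{x. f x > 0}\<close> never leaves that set.\<close>

section \<open>Hausdorff measure and length of curves\<close>

text \<open>The 1-Lipschitz function \<open>dist a\<close> maps \<open>C\<close> onto a set containing the
interval from 0 to \<open>dist a b\<close>, and maps each \<open>U j\<close> into an interval
whose length is the diameter of \<open>U j\<close>. Subadditivity of Lebesgue measure on the
line then gives the bound.\<close>

lemma dist_le_sum_diameter_cover:
  fixes C :: "'a::metric_space set"
  assumes "connected C" "a \<in> C" "b \<in> C" and cover: "C \<subseteq> (\<Union>j. U j)"
    and bdd: "\<And>j::nat. bounded (U j)"
  shows "ennreal (dist a b) \<le> (\<Sum>j. ennreal (diameter (U j)))"
proof -
  define m where "m j = (INF x\<in>U j. dist a x)" for j
  define I where "I j = (if U j = {} then {} else {m j .. m j + diameter (U j)})" for j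
  have mem: "dist a x \<in> I j" if "x \<in> U j" for x j
  proof -
    have "m j \<le> dist a x"
      unfolding m_def using that by (intro cINF_lower) (auto intro: bdd_belowI[of _ 0])
    moreover have "dist a x - diameter (U j) \<le> m j"
      unfolding m_def
    proof (rule cINF_greatest)
      show "U j \<noteq> {}" using that by auto
      fix y assume "y \<in> U j"
      then have "dist x y \<le> diameter (U j)"
        using diameter_bounded_bound bdd that by blast
      then show "dist a x - diameter (U j) \<le> dist a y"
        using dist_triangle[of a x y] by (simp add: dist_commute)
    qed
    ultimately show ?thesis using that by (auto simp: I_def)
  qed
  have "{0..dist a b} \<subseteq> dist a ` C"
  proof -
    have "connected (dist a ` C)"
      by (intro connected_continuous_image continuous_intros assms)
    moreover have "0 \<in> dist a ` C" "dist a b \<in> dist a ` C"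
      using assms by force+
    ultimately show ?thesis
      by (meson connected_contains_Icc)
  qed
  moreover have "dist a ` C \<subseteq> (\<Union>j. I j)"
  proof clarify
    fix x assume "x \<in> C"
    then obtain j where "x \<in> U j" using cover by auto
    then show "dist a x \<in> (\<Union>j. I j)" using mem by auto
  qed
  ultimately have "{0..dist a b} \<subseteq> (\<Union>j. I j)" by (rule order_trans)
  then have "emeasure lborel {0..dist a b} \<le> emeasure lborel (\<Union>j. I j)"
    by (intro emeasure_mono) (auto simp: I_def)
  also have "\<dots> \<le> (\<Sum>j. emeasure lborel (I j))"
    by (intro emeasure_subadditive_countably) (auto simp: I_def)
  also have "\<dots> \<le> (\<Sum>j. ennreal (diameter (U j)))"
    by (intro suminf_le) (auto simp: I_def diameter_ge_0 bdd)
  finally show ?thesis by simp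
qed

text \<open>Once the covering sets are smaller than the gaps between the pieces \<open>C k\<close>, each of
them meets at most one piece, so the bounds for the single pieces add up.\<close>

lemma sum_dist_le_hausdorff1:
  fixes C :: "'k \<Rightarrow> 'a::metric_space set"
  assumes "finite K" and conn: "\<And>k. k \<in> K \<Longrightarrow> connected (C k)"
    and a: "\<And>k. k \<in> K \<Longrightarrow> a k \<in> C k" and b: "\<And>k. k \<in> K \<Longrightarrow> b k \<in> C k"
    and sub: "\<And>k. k \<in> K \<Longrightarrow> C k \<subseteq> A"
    and "\<delta> > 0"
    and sep: "\<And>k l x y. k \<in> K \<Longrightarrow> l \<in> K \<Longrightarrow> k \<noteq> l \<Longrightarrow> x \<in> C k \<Longrightarrow> y \<in> C l \<Longrightarrow> \<delta> < dist x y"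
  shows "ennreal (\<Sum>k\<in>K. dist (a k) (b k)) \<le> hausdorff1 A"
proof -
  have "ennreal (\<Sum>k\<in>K. dist (a k) (b k)) \<le> hausdorff1_pre \<delta> A"
    unfolding hausdorff1_pre_def
  proof (rule INF_greatest)
    fix U :: "nat \<Rightarrow> 'a set"
    assume "U \<in> {U. A \<subseteq> (\<Union>j. U j) \<and> (\<forall>j. bounded (U j) \<and> diameter (U j) \<le> \<delta>)}"
    then have cover: "A \<subseteq> (\<Union>j. U j)" and bdd: "\<And>j. bounded (U j)"
      and diam: "\<And>j. diameter (U j) \<le> \<delta>" by auto
    define V where "V k j = (if U j \<inter> C k = {} then {} else U j)" for k j
    have bddV: "bounded (V k j)" for k j using bdd by (auto simp: V_def)
    have "ennreal (\<Sum>k\<in>K. dist (a k) (b k)) = (\<Sum>k\<in>K. ennreal (dist (a k) (b k)))"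
      by simp
    also have "\<dots> \<le> (\<Sum>k\<in>K. \<Sum>j. ennreal (diameter (V k j)))"
    proof (rule sum_mono)
      fix k assume k: "k \<in> K"
      show "ennreal (dist (a k) (b k)) \<le> (\<Sum>j. ennreal (diameter (V k j)))"
      proof (rule dist_le_sum_diameter_cover[OF conn[OF k] a[OF k] b[OF k]])
        show "C k \<subseteq> (\<Union>j. V k j)"
        proof
          fix x assume "x \<in> C k"
          moreover from this obtain j where "x \<in> U j" using cover sub k by blast
          ultimately have "x \<in> V k j" by (auto simp: V_def)
          then show "x \<in> (\<Union>j. V k j)" by auto
        qed
      qed (rule bddV)
    qed
    also have "\<dots> = (\<Sum>j. \<Sum>k\<in>K. ennreal (diameter (V k j)))"
      by (intro suminf_sum[symmetric]) auto
    also have "\<dots> \<le> (\<Sum>j. ennreal (diameter (U j)))"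
    proof (rule suminf_le)
      fix j
      show "(\<Sum>k\<in>K. ennreal (diameter (V k j))) \<le> ennreal (diameter (U j))"
      proof (cases "\<exists>k\<in>K. U j \<inter> C k \<noteq> {}")
        case False
        then have "(\<Sum>k\<in>K. ennreal (diameter (V k j))) = 0"
          by (intro sum.neutral) (auto simp: V_def)
        then show ?thesis by simp
      next
        case True
        then obtain k x where k: "k \<in> K" "x \<in> U j" "x \<in> C k" by auto
        have "U j \<inter> C l = {}" if "l \<in> K - {k}" for l
        proof (rule ccontr)
          assume "U j \<inter> C l \<noteq> {}"
          then obtain y where y: "y \<in> U j" "y \<in> C l" by auto
          have "dist x y \<le> \<delta>"
            using diameter_bounded_bound[OF bdd k(2) y(1)] diam[of j] by linarith
          then show False using sep[of k l x y] k y that by auto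
        qed
        then have "(\<Sum>l\<in>K-{k}. ennreal (diameter (V l j))) = 0"
          by (intro sum.neutral) (auto simp: V_def)
        then show ?thesis
          using k \<open>finite K\<close> by (auto simp: sum.remove[of K k] V_def)
      qed
    qed auto
    finally show "ennreal (\<Sum>k\<in>K. dist (a k) (b k)) \<le> (\<Sum>j. ennreal (diameter (U j)))" .
  qed
  also have "\<dots> \<le> hausdorff1 A"
    unfolding hausdorff1_def using \<open>\<delta> > 0\<close> by (intro SUP_upper) auto
  finally show ?thesis .
qed

lemma hausdorff1_mono: "A \<subseteq> B \<Longrightarrow> hausdorff1 A \<le> hausdorff1 B"
  unfolding hausdorff1_def hausdorff1_pre_def
  by (intro SUP_mono' INF_superset_mono) auto

text \<open>Consecutive subarcs of an arc share an endpoint, so they are not separated. Shrinking each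
parameter interval by \<open>\<eta> / N\<close> at both ends makes the subarcs disjoint compact
sets with positive mutual distances, because the inverse of the arc is uniformly continuous;
then \<open>\<eta>\<close> tends to 0.\<close>

lemma arc_polygon_le_hausdorff1:
  fixes q :: "real \<Rightarrow> 'a::metric_space"
  assumes "arc q" and "N > 0" and L: "hausdorff1 (path_image q) \<le> ennreal L" "L \<ge> 0"
  shows "(\<Sum>k<N. dist (q (real k / N)) (q (real (Suc k) / N))) \<le> L"
proof -
  define u where "u \<eta> k = (real k + \<eta>) / N" for \<eta> k
  define v where "v \<eta> k = (real (Suc k) - \<eta>) / N" for \<eta> k
  obtain h where hom: "homeomorphism {0..1} (path_image q) q h"
    using homeomorphism_arc[OF \<open>arc q\<close>] by blast
  have ucont: "uniformly_continuous_on (path_image q) h"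
    using hom arc_imp_path[OF \<open>arc q\<close>]
    by (intro compact_uniformly_continuous) (auto simp: homeomorphism_def compact_path_image)
  have contq: "continuous_on {0..1} q"
    using arc_imp_path[OF \<open>arc q\<close>] by (simp add: path_def)
  have shrunk: "(\<Sum>k<N. dist (q (u \<eta> k)) (q (v \<eta> k))) \<le> L" if \<eta>: "0 < \<eta>" "\<eta> < 1/2" for \<eta>
  proof -
    have le: "0 \<le> u \<eta> k" "u \<eta> k \<le> v \<eta> k" "v \<eta> k \<le> 1" if "k < N" for k
      using \<eta> that by (auto simp: u_def v_def divide_simps)
    have "0 < \<eta> / N" using \<eta> \<open>N > 0\<close> by simp
    then obtain \<delta> where \<delta>: "\<delta> > 0"
      "\<And>x y. x \<in> path_image q \<Longrightarrow> y \<in> path_image q \<Longrightarrow> dist y x < \<delta> \<Longrightarrow> dist (h y) (h x) < \<eta> / N"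
      using ucont unfolding uniformly_continuous_on_def by metis
    have gap: "\<eta> / N \<le> t - s" if "k < l" "l < N" "s \<le> v \<eta> k" "u \<eta> l \<le> t" for k l s t
    proof -
      have "(real (Suc k) + \<eta>) / N \<le> u \<eta> l"
        unfolding u_def using that \<open>N > 0\<close> by (intro divide_right_mono) auto
      moreover have "(real (Suc k) + \<eta>) / N - v \<eta> k = 2 * (\<eta> / N)"
        by (simp add: v_def diff_divide_distrib add_divide_distrib)
      ultimately show ?thesis using that \<open>0 < \<eta> / N\<close> by linarith
    qed
    have "ennreal (\<Sum>k<N. dist (q (u \<eta> k)) (q (v \<eta> k))) \<le> hausdorff1 (path_image q)"
    proof (rule sum_dist_le_hausdorff1[where C = "\<lambda>k. q ` {u \<eta> k .. v \<eta> k}" and \<delta> = "\<delta>/2"])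
      fix k assume "k \<in> {..<N}"
      then have "{u \<eta> k .. v \<eta> k} \<subseteq> {0..1}" using le[of k] by auto
      then show "connected (q ` {u \<eta> k .. v \<eta> k})" "q ` {u \<eta> k .. v \<eta> k} \<subseteq> path_image q"
        by (auto intro!: connected_continuous_image continuous_on_subset[OF contq] simp: path_image_def)
    next
      fix k l x y
      assume kl: "k \<in> {..<N}" "l \<in> {..<N}" "k \<noteq> l" "x \<in> q ` {u \<eta> k .. v \<eta> k}" "y \<in> q ` {u \<eta> l .. v \<eta> l}"
      then obtain s t where st: "x = q s" "y = q t" "s \<in> {u \<eta> k .. v \<eta> k}" "t \<in> {u \<eta> l .. v \<eta> l}" by auto
      have 01: "s \<in> {0..1}" "t \<in> {0..1}" using st le[of k] le[of l] kl by auto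
      have "h x = s" "h y = t" using st hom 01 by (auto simp: homeomorphism_def)
      moreover have "x \<in> path_image q" "y \<in> path_image q" using 01 st by (auto simp: path_image_def)
      moreover have "\<eta> / N \<le> dist s t"
        using gap[of k l s t] gap[of l k t s] kl st by (cases "k < l") (auto simp: dist_real_def)
      ultimately have "\<not> dist x y < \<delta>"
        using \<delta>(2)[of y x] by auto
      then show "\<delta> / 2 < dist x y" using \<open>\<delta> > 0\<close> by linarith
    qed (use le \<delta> in auto)
    also note L(1)
    finally show ?thesis using L(2) by simp
  qed
  have lim: "((\<lambda>\<eta>. \<Sum>k<N. dist (q (u \<eta> k)) (q (v \<eta> k)))
               \<longlongrightarrow> (\<Sum>k<N. dist (q (real k / N)) (q (real (Suc k) / N)))) (at_right 0)"
  proof (intro tendsto_sum tendsto_dist)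
    fix k assume "k \<in> {..<N}"
    then have k: "k < N" by simp
    have ev: "\<forall>\<^sub>F \<eta> in at_right 0. 0 < \<eta> \<and> \<eta> < (1/2::real)"
      by (intro eventually_conj eventually_at_right_less eventually_at_rightI[of 0 "1/2"]) auto
    show "((\<lambda>\<eta>. q (u \<eta> k)) \<longlongrightarrow> q (real k / N)) (at_right 0)"
    proof (rule continuous_on_tendsto_compose[OF contq])
      show "((\<lambda>\<eta>. u \<eta> k) \<longlongrightarrow> real k / N) (at_right 0)"
        unfolding u_def by (rule tendsto_eq_intros refl | use \<open>N > 0\<close> in simp)+
      show "\<forall>\<^sub>F \<eta> in at_right 0. u \<eta> k \<in> {0..1}"
        using ev by eventually_elim (use k in \<open>auto simp: u_def divide_simps\<close>)
    qed (use k in \<open>auto simp: divide_simps\<close>)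
    show "((\<lambda>\<eta>. q (v \<eta> k)) \<longlongrightarrow> q (real (Suc k) / N)) (at_right 0)"
    proof (rule continuous_on_tendsto_compose[OF contq])
      show "((\<lambda>\<eta>. v \<eta> k) \<longlongrightarrow> real (Suc k) / N) (at_right 0)"
        unfolding v_def by (rule tendsto_eq_intros refl | use \<open>N > 0\<close> in simp)+
      show "\<forall>\<^sub>F \<eta> in at_right 0. v \<eta> k \<in> {0..1}"
        using ev by eventually_elim (use k in \<open>auto simp: v_def divide_simps\<close>)
    qed (use k in \<open>auto simp: divide_simps\<close>)
  qed
  show ?thesis
  proof (rule tendsto_upperbound[OF lim])
    show "\<forall>\<^sub>F \<eta> in at_right 0. (\<Sum>k<N. dist (q (u \<eta> k)) (q (v \<eta> k))) \<le> L"
      using shrunk by (intro eventually_at_rightI[of 0 "1/2"]) auto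
  qed simp
qed

text \<open>This replaces a parametrisation by arc length. If \<open>x 0, \<dots>, x N\<close> are the
vertices of a polygon inscribed in an arc, with sides at most \<open>\<epsilon>\<close>, and
\<open>P k\<close> is the length of the polygon up to \<open>x k\<close>, then \<open>g
s\<close> is the last vertex \<open>x k\<close> with \<open>P k \<le> s * P N\<close>. The
distance of two vertices is at most the difference of their values of \<open>P\<close>, and
stopping at a vertex loses at most one side. The step function keeps to the image of the path,
unlike the polygon itself.\<close>

lemma path_discretization:
  fixes p :: "real \<Rightarrow> 'a::{complete_space,real_normed_vector}"
  assumes "path p" and L: "hausdorff1 (path_image p) \<le> ennreal L" "L \<ge> 0" and "\<epsilon> > 0"
  obtains g :: "real \<Rightarrow> 'a" where "g 0 = p 0" "g 1 = p 1" "range g \<subseteq> path_image p"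
    "\<And>s t. s \<in> {0..1} \<Longrightarrow> t \<in> {0..1} \<Longrightarrow> dist (g s) (g t) \<le> L * dist s t + \<epsilon>"
proof (cases "p 0 = p 1")
  case True
  show ?thesis
    by (rule that[of "\<lambda>_. p 0"]) (use True L \<open>\<epsilon> > 0\<close> in \<open>auto simp: path_image_def\<close>)
next
  case False
  obtain q where q: "arc q" "path_image q \<subseteq> path_image p" "q 0 = p 0" "q 1 = p 1"
    using path_contains_arc[OF \<open>path p\<close> refl refl] False
    by (auto simp: pathstart_def pathfinish_def)
  have "uniformly_continuous_on {0..1} q"
    using arc_imp_path[OF q(1)] by (auto simp: path_def intro: compact_uniformly_continuous)
  then obtain d where d: "d > 0"
    "\<And>s t. s \<in> {0..1} \<Longrightarrow> t \<in> {0..1} \<Longrightarrow> dist s t < d \<Longrightarrow> dist (q s) (q t) < \<epsilon>"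
    using \<open>\<epsilon> > 0\<close> unfolding uniformly_continuous_on_def by metis
  obtain N where N: "N > 0" "1 / real N < d"
    using real_arch_invD[OF d(1)] by (auto simp: inverse_eq_divide)
  define x where "x k = q (real k / N)" for k :: nat
  define P where "P k = (\<Sum>j<k. dist (x j) (x (Suc j)))" for k
  have x_in: "x k \<in> path_image q" if "k \<le> N" for k
    using that N by (auto simp: x_def path_image_def divide_simps)
  have x0: "x 0 = p 0" and xN: "x N = p 1" using q N by (auto simp: x_def)
  have step: "P (Suc k) \<le> P k + \<epsilon>" if "k < N" for k
  proof -
    have "dist (real k / N) (real (Suc k) / N) = 1 / N"
      using N by (simp add: dist_real_def field_simps)
    then have "dist (x k) (x (Suc k)) < \<epsilon>"
      unfolding x_def using that N(2) N(1)
      by (intro d(2)) (simp_all only: atLeastAtMost_iff, auto simp: divide_simps)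
    then show ?thesis by (simp add: P_def)
  qed
  have P_dist: "dist (x k) (x l) \<le> P l - P k" if "k \<le> l" for k l
    using that
  proof (induction rule: dec_induct)
    case (step l)
    then show ?case using dist_triangle[of "x k" "x (Suc l)" "x l"] by (simp add: P_def)
  qed simp
  have P_mono: "P k \<le> P l" if "k \<le> l" for k l
    using P_dist[OF that] zero_le_dist[of "x k" "x l"] by linarith
  have PN: "P N \<le> L"
  proof -
    have "hausdorff1 (path_image q) \<le> ennreal L"
      using hausdorff1_mono[OF q(2)] L(1) by (rule order_trans)
    then show ?thesis
      unfolding P_def x_def using arc_polygon_le_hausdorff1[OF q(1) N(1) _ L(2)] by simp
  qed
  have PN0: "0 \<le> P N" by (simp add: P_def sum_nonneg)
  \<comment> \<open>the last vertex reached by time \<open>s\<close> when the polygon is traversed at constant speed\<close>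
  define k where "k s = Max {j. j \<le> N \<and> P j \<le> s * P N}" for s
  have kmem: "k s \<le> N \<and> P (k s) \<le> s * P N" if "0 \<le> s" for s
  proof -
    have "0 \<in> {j. j \<le> N \<and> P j \<le> s * P N}" using that PN0 by (simp add: P_def)
    then have "k s \<in> {j. j \<le> N \<and> P j \<le> s * P N}"
      unfolding k_def by (intro Max_in) auto
    then show ?thesis by simp
  qed
  have kmax: "j \<le> k s" if "j \<le> N" "P j \<le> s * P N" for j s
    unfolding k_def using that by (intro Max_ge) auto
  have klow: "s * P N \<le> P (k s) + \<epsilon>" if "0 \<le> s" "s \<le> 1" for s
  proof (cases "k s = N")
    case True
    then show ?thesis using that PN0 \<open>\<epsilon> > 0\<close> mult_right_mono[of s 1 "P N"] by auto
  next
    case False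
    then have "k s < N" using kmem that by (simp add: le_neq_implies_less)
    moreover have "s * P N < P (Suc (k s))"
      using kmax[of "Suc (k s)" s] \<open>k s < N\<close> by (metis Suc_leI Suc_n_not_le_n not_le)
    ultimately show ?thesis using step[of "k s"] by linarith
  qed
  have ordered: "dist (x (k s)) (x (k t)) \<le> L * (t - s) + \<epsilon>" if st: "0 \<le> s" "s \<le> t" "t \<le> 1" for s t
  proof -
    have "s * P N \<le> t * P N" using st PN0 by (intro mult_right_mono) auto
    then have "k s \<le> k t" using kmem[of s] st by (intro kmax) auto
    then have "dist (x (k s)) (x (k t)) \<le> P (k t) - P (k s)" by (rule P_dist)
    also have "\<dots> \<le> t * P N - s * P N + \<epsilon>" using kmem[of t] klow[of s] st by auto
    also have "t * P N - s * P N = (t - s) * P N" by (simp add: algebra_simps)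
    also have "\<dots> \<le> (t - s) * L" using st PN by (intro mult_left_mono) auto
    finally show ?thesis by (simp add: mult.commute)
  qed
  define g where "g s = (if s \<in> {0..1} then x (k s) else p 0)" for s
  show ?thesis
  proof (rule that[of g])
    \<comment> \<open>\<open>k 0\<close> need not be 0 a priori, but the polygon has length 0 up to that vertex\<close>
    have "dist (x 0) (x (k 0)) \<le> P (k 0) - P 0" by (intro P_dist) simp
    moreover have "P (k 0) \<le> 0" "P 0 = 0" using kmem[of 0] by (simp_all add: P_def)
    ultimately have "dist (x 0) (x (k 0)) \<le> 0" by linarith
    then show "g 0 = p 0" using x0 by (simp add: g_def)
    have "k 1 = N" using kmem[of 1] kmax[of N 1] by auto
    then show "g 1 = p 1" using xN by (simp add: g_def)
    show "range g \<subseteq> path_image p"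
      using x_in kmem q(2) by (fastforce simp: g_def path_image_def)
    fix s t :: real assume "s \<in> {0..1}" "t \<in> {0..1}"
    then show "dist (g s) (g t) \<le> L * dist s t + \<epsilon>"
      using ordered[of s t] ordered[of t s]
      by (cases "s \<le> t") (auto simp: g_def dist_real_def dist_commute)
  qed
qed

lemma Lipschitz_curve_length:
  fixes \<gamma> :: "real \<Rightarrow> 'a::metric_space"
  assumes lip: "\<And>s t. s \<in> {0..1} \<Longrightarrow> t \<in> {0..1} \<Longrightarrow> dist (\<gamma> s) (\<gamma> t) \<le> L * dist s t" and "L \<ge> 0"
  shows "rectifiable_curve \<gamma>" and "hausdorff1 (path_image \<gamma>) \<le> ennreal L"
proof -
  have "L-lipschitz_on {0..1} \<gamma>"
    using assms by (auto simp: lipschitz_on_def)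
  then have "path \<gamma>"
    using lipschitz_on_continuous_on by (auto simp: path_def)
  moreover have "curve_length \<gamma> \<le> ennreal L"
    unfolding curve_length_def
  proof (rule SUP_least, clarify)
    fix m :: nat and s :: "nat \<Rightarrow> real" assume s: "mono s" "range s \<subseteq> {0..1}"
    then have s01: "s k \<in> {0..1}" for k by blast
    have "(\<Sum>k<m. dist (\<gamma> (s k)) (\<gamma> (s (Suc k)))) \<le> (\<Sum>k<m. L * (s (Suc k) - s k))"
    proof (rule sum_mono)
      fix k
      have "s k \<le> s (Suc k)" using s by (simp add: monoD)
      then show "dist (\<gamma> (s k)) (\<gamma> (s (Suc k))) \<le> L * (s (Suc k) - s k)"
        using lip[OF s01[of k] s01[of "Suc k"]] by (simp add: dist_real_def)
    qed
    also have "\<dots> = L * (s m - s 0)"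
      by (simp add: sum_distrib_left[symmetric] sum_lessThan_telescope)
    also have "\<dots> \<le> L * 1" using s01[of m] s01[of 0] \<open>L \<ge> 0\<close> by (intro mult_left_mono) auto
    finally show "(\<Sum>k<m. ennreal (dist (\<gamma> (s k)) (\<gamma> (s (Suc k))))) \<le> ennreal L"
      by (simp add: ennreal_leI)
  qed
  ultimately show "rectifiable_curve \<gamma>"
    unfolding rectifiable_curve_def using le_less_trans[OF _ ennreal_less_top] by auto
  show "hausdorff1 (path_image \<gamma>) \<le> ennreal L"
    unfolding hausdorff1_def
  proof (rule SUP_least)
    fix \<delta> :: real assume "\<delta> \<in> {0<..}"
    then have "\<delta> > 0" by simp
    obtain N :: nat where N: "N > 0" "L / N \<le> \<delta>"
    proof -
      obtain n where "L / \<delta> < real n" using reals_Archimedean2 by blast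
      then have "L / \<delta> < real (Suc n)" by simp
      then show ?thesis using \<open>\<delta> > 0\<close> by (intro that[of "Suc n"]) (auto simp: field_simps)
    qed
    define U where "U j = (if j < N then \<gamma> ` {real j / N .. real (Suc j) / N} else {})" for j :: nat
    have close: "dist a b \<le> L / N" if "a \<in> U j" "b \<in> U j" for a b j
    proof -
      have "j < N" using that by (auto simp: U_def split: if_splits)
      from that obtain s t where st: "a = \<gamma> s" "b = \<gamma> t"
        "s \<in> {real j / N .. real (Suc j) / N}" "t \<in> {real j / N .. real (Suc j) / N}"
        by (auto simp: U_def split: if_splits)
      have "0 \<le> real j / N" "real (Suc j) / N \<le> 1" using \<open>j < N\<close> by (auto simp: divide_simps)
      then have "s \<in> {0..1}" "t \<in> {0..1}"
        using st(3,4) unfolding atLeastAtMost_iff by linarith+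
      then have "dist a b \<le> L * dist s t" using lip st by auto
      also have "real (Suc j) / N - real j / N = 1 / N" by (simp add: diff_divide_distrib[symmetric])
      then have "dist s t \<le> 1 / N" using st by (auto simp: dist_real_def)
      then have "L * dist s t \<le> L * (1 / N)" using \<open>L \<ge> 0\<close> by (intro mult_left_mono)
      finally show ?thesis by simp
    qed
    have bdd: "bounded (U j)" for j
    proof (cases "U j = {}")
      case False
      then obtain a where "a \<in> U j" by auto
      then show ?thesis using close[of a j] unfolding bounded_def by blast
    qed simp
    have diam: "diameter (U j) \<le> L / N" for j
      unfolding diameter_def using close \<open>L \<ge> 0\<close> by (auto intro!: cSUP_least)
    have "path_image \<gamma> \<subseteq> (\<Union>j. U j)"
    proof
      fix y assume "y \<in> path_image \<gamma>"
      then obtain t where t: "y = \<gamma> t" "0 \<le> t" "t \<le> 1" by (auto simp: path_image_def)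
      have "\<exists>j<N. t \<in> {real j / N .. real (Suc j) / N}"
      proof (cases "t = 1")
        case True
        obtain n where "N = Suc n" using N(1) gr0_implies_Suc by blast
        then show ?thesis using True by (intro exI[of _ n]) (simp add: field_simps)
      next
        case False
        define j where "j = nat \<lfloor>t * N\<rfloor>"
        have j: "real j \<le> t * N" "t * N < real j + 1"
          using t unfolding j_def by (simp_all add: of_nat_floor)
        have "t * real N < 1 * real N"
          using False t N(1) by (intro mult_strict_right_mono) auto
        then have "j < N" using j by linarith
        moreover have "real j / N \<le> t" "t \<le> real (Suc j) / N"
          using j N(1) by (simp_all add: divide_le_eq le_divide_eq)
        ultimately show ?thesis by auto
      qed
      then obtain j where j: "j < N" "t \<in> {real j / N .. real (Suc j) / N}" by auto
      then have "y \<in> U j" unfolding U_def t(1) by (simp only: if_True imageI)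
      then show "y \<in> (\<Union>j. U j)" by blast
    qed
    then have "hausdorff1_pre \<delta> (path_image \<gamma>) \<le> (\<Sum>j. ennreal (diameter (U j)))"
      unfolding hausdorff1_pre_def using bdd order_trans[OF diam N(2)]
      by (intro INF_lower) blast
    also have "\<dots> = (\<Sum>j<N. ennreal (diameter (U j)))"
      by (intro suminf_finite) (auto simp: U_def)
    also have "\<dots> \<le> (\<Sum>j<N. ennreal (L / N))"
      using diam by (intro sum_mono ennreal_leI)
    also have "\<dots> = ennreal L"
      using \<open>L \<ge> 0\<close> N(1) by (simp add: ennreal_mult'[symmetric] ennreal_of_nat_eq_real_of_nat)
    finally show "hausdorff1_pre \<delta> (path_image \<gamma>) \<le> ennreal L" .
  qed
qed

section \<open>Pointwise compactness of almost Lipschitz functions\<close>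

text \<open>A diagonal argument gives convergence on a countable dense subset. The error terms
\<open>\<epsilon> n\<close> vanish in the limit, so the values at any other point form a Cauchy
sequence. Allowing errors admits discontinuous functions.\<close>

lemma asymptotically_Lipschitz_convergent_subsequence:
  fixes F :: "nat \<Rightarrow> 'a::{metric_space,second_countable_topology} \<Rightarrow> 'b::{banach,heine_borel}"
  assumes bound: "\<And>n x. x \<in> S \<Longrightarrow> norm (F n x) \<le> B"
    and lip: "\<And>n x y. x \<in> S \<Longrightarrow> y \<in> S \<Longrightarrow> dist (F n x) (F n y) \<le> L * dist x y + \<epsilon> n"
    and "\<epsilon> \<longlonglongrightarrow> 0"
  obtains r g where "strict_mono (r :: nat \<Rightarrow> nat)" "\<And>x. x \<in> S \<Longrightarrow> (\<lambda>n. F (r n) x) \<longlonglongrightarrow> g x"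
proof -
  obtain T where T: "countable T" "T \<subseteq> S" "S \<subseteq> closure T"
    using separable by blast
  obtain r where r: "strict_mono (r :: nat \<Rightarrow> nat)"
    and conv: "\<And>x. x \<in> T \<Longrightarrow> \<exists>l. (\<lambda>n. F (r n) x) \<longlonglongrightarrow> l"
    using function_convergent_subsequence[OF T(1), of F B] bound T(2) by (metis subsetD)
  have "convergent (\<lambda>n. F (r n) x)" if x: "x \<in> S" for x
  proof (rule Cauchy_convergent, rule metric_CauchyI)
    fix e :: real assume "e > 0"
    define d where "d = e / (6 * (\<bar>L\<bar> + 1))"
    have "d > 0" unfolding d_def using \<open>e > 0\<close> by simp
    then obtain y where y: "y \<in> T" "dist y x < d"
      using T(3) x closure_approachable[of x T] by blast
    have Ld: "L * dist x y \<le> e / 6"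
    proof -
      have "L * dist x y \<le> (\<bar>L\<bar> + 1) * d"
        using y by (intro mult_mono) (auto simp: dist_commute)
      also have "\<dots> = e / 6" by (simp add: d_def field_simps)
      finally show ?thesis .
    qed
    have "Cauchy (\<lambda>n. F (r n) y)"
      using conv[OF y(1)] convergent_Cauchy by (auto simp: convergent_def)
    then obtain N1 where N1: "\<And>m n. m \<ge> N1 \<Longrightarrow> n \<ge> N1 \<Longrightarrow> dist (F (r m) y) (F (r n) y) < e / 6"
      using \<open>e > 0\<close> metric_CauchyD[of _ "e/6"] by (metis divide_pos_pos zero_less_numeral)
    have "\<forall>\<^sub>F n in sequentially. \<epsilon> n < e / 6"
      using \<open>\<epsilon> \<longlonglongrightarrow> 0\<close> \<open>e > 0\<close> by (intro order_tendstoD) auto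
    then obtain N2 where N2: "\<And>n. n \<ge> N2 \<Longrightarrow> \<epsilon> n < e / 6"
      by (auto simp: eventually_sequentially)
    have close: "dist (F (r n) x) (F (r n) y) < e / 3" if "n \<ge> N2" for n
    proof -
      have "r n \<ge> N2" using that seq_suble[OF r, of n] by linarith
      then show ?thesis
        using lip[of x y "r n"] \<open>x \<in> S\<close> y T(2) Ld N2[of "r n"] by force
    qed
    show "\<exists>N. \<forall>m\<ge>N. \<forall>n\<ge>N. dist (F (r m) x) (F (r n) x) < e"
    proof (intro exI allI impI)
      fix m n assume mn: "m \<ge> max N1 N2" "n \<ge> max N1 N2"
      have "dist (F (r m) x) (F (r n) x)
            \<le> dist (F (r m) x) (F (r m) y) + dist (F (r m) y) (F (r n) y) + dist (F (r n) x) (F (r n) y)"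
        by metric
      then show "dist (F (r m) x) (F (r n) x) < e"
        using close[of m] close[of n] N1[of m n] mn \<open>e > 0\<close> by force
    qed
  qed
  then show thesis
    using that[OF r, of "\<lambda>x. lim (\<lambda>n. F (r n) x)"] by (simp add: convergent_LIMSEQ_iff)
qed

section \<open>Porous sets\<close>

text \<open>By the Vitali covering theorem, disjoint balls \<open>A i\<close> inside an open set
\<open>T\<close> that contains \<open>P\<close> cover almost all of \<open>P\<close>. Each
\<open>A i\<close> contains a hole \<open>H i\<close> with a fixed fraction \<open>q\<close> of
its volume. The holes are disjoint and lie in \<open>T - P\<close>, so \<open>T - P\<close> has
measure at least \<open>q\<close> times that of \<open>P\<close>. By outer regularity it can be
made smaller than this unless \<open>P\<close> is null.\<close>

lemma negligible_porous:
  fixes P :: "'a::euclidean_space set"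
  assumes P: "P \<in> lmeasurable" and c: "0 < c" "c \<le> 1"
    and porous: "\<And>x \<delta>. x \<in> P \<Longrightarrow> \<delta> > 0 \<Longrightarrow>
      \<exists>r z. 0 < r \<and> r < \<delta> \<and> dist z x \<le> r \<and> ball z (c * r) \<inter> P = {}"
  shows "negligible P"
proof (rule ccontr)
  assume "\<not> negligible P"
  define q where "q = (c / 2) ^ DIM('a)"
  have "q > 0" using c by (simp add: q_def)
  have "measure lebesgue P > 0"
    using \<open>\<not> negligible P\<close> P negligible_iff_measure zero_less_measure_iff by blast
  then have "q * measure lebesgue P > 0" using \<open>q > 0\<close> by simp
  then obtain T where T: "open T" "P \<subseteq> T" and "T - P \<in> lmeasurable"
    and small: "emeasure lebesgue (T - P) < ennreal (q * measure lebesgue P)"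
    using sets_lebesgue_outer_open P by (metis fmeasurableD)
  \<comment> \<open>The hole has its centre within distance \<open>r\<close> of \<open>x\<close>, so the ball of radius \<open>2 * r\<close> contains it.\<close>
  define K where "K = {(x, r, z). r > 0 \<and> ball x (2 * r) \<subseteq> T \<and> dist z x \<le> r \<and> ball z (c * r) \<inter> P = {}}"
  define A where "A i = ball (fst i) (2 * fst (snd i))" for i :: "'a \<times> real \<times> 'a"
  define H where "H i = ball (snd (snd i)) (c * fst (snd i))" for i :: "'a \<times> real \<times> 'a"
  obtain C where C: "countable C" "C \<subseteq> K"
    and disj: "pairwise (\<lambda>i j. disjnt (A i) (A j)) C"
    and neg: "negligible (P - (\<Union>i\<in>C. A i))"
    unfolding A_def
  proof (rule Vitali_covering_theorem_balls[of P K fst "\<lambda>i. 2 * fst (snd i)"])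
    fix x d assume "x \<in> P" "0 < (d::real)"
    then obtain \<eta> where \<eta>: "\<eta> > 0" "ball x \<eta> \<subseteq> T" using T by (meson open_contains_ball subsetD)
    then obtain r z where rz: "0 < r" "r < min \<eta> d / 2" "dist z x \<le> r" "ball z (c * r) \<inter> P = {}"
      using porous[OF \<open>x \<in> P\<close>, of "min \<eta> d / 2"] \<open>0 < d\<close> by auto
    have "ball x (2 * r) \<subseteq> ball x \<eta>" using rz by (intro subset_ball) auto
    then have "(x, r, z) \<in> K" using rz \<eta> by (auto simp: K_def)
    then show "\<exists>i. i \<in> K \<and> x \<in> ball (fst i) (2 * fst (snd i)) \<and> 2 * fst (snd i) < d"
      using rz by (intro exI[of _ "(x, r, z)"]) auto
  qed blast
  have HA: "H i \<subseteq> A i" "A i \<subseteq> T" "H i \<inter> P = {}" if "i \<in> C" for i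
  proof -
    obtain x r z where i: "i = (x, r, z)" by (metis prod_cases3)
    have k: "r > 0" "ball x (2 * r) \<subseteq> T" "dist z x \<le> r" "ball z (c * r) \<inter> P = {}"
      using that C(2) by (auto simp: K_def i)
    have "c * r \<le> 1 * r" using c k by (intro mult_right_mono) auto
    then have "dist z x + c * r \<le> 2 * r" using k by linarith
    then show "H i \<subseteq> A i" by (simp add: A_def H_def i ball_subset_ball_iff)
    show "A i \<subseteq> T" "H i \<inter> P = {}" using k by (auto simp: A_def H_def i)
  qed
  have vol: "emeasure lebesgue (H i) = ennreal q * emeasure lebesgue (A i)" if "i \<in> C" for i
  proof -
    have r: "fst (snd i) > 0" using that C(2) by (auto simp: K_def)
    have "c * fst (snd i) = c / 2 * (2 * fst (snd i))" by simp
    then have "(c * fst (snd i)) ^ DIM('a) = q * (2 * fst (snd i)) ^ DIM('a)"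
      unfolding q_def by (metis power_mult_distrib)
    then show ?thesis
      using r c \<open>q > 0\<close>
      by (simp add: A_def H_def emeasure_ball ennreal_mult''[symmetric] mult_ac emeasure_lborel_ball_finite)
  qed
  have disjA: "disjoint_family_on A C"
    using disj by (auto simp: disjoint_family_on_def pairwise_def disjnt_def)
  have disjH: "disjoint_family_on H C"
    unfolding disjoint_family_on_def
  proof (intro ballI impI)
    fix i j assume ij: "i \<in> C" "j \<in> C" "i \<noteq> j"
    then have "A i \<inter> A j = {}" using disjA by (auto simp: disjoint_family_on_def)
    then show "H i \<inter> H j = {}" using HA(1)[of i] HA(1)[of j] ij by blast
  qed
  have sets: "A i \<in> sets lebesgue" "H i \<in> sets lebesgue" for i
    by (simp_all add: A_def H_def)
  have "emeasure lebesgue P \<le> emeasure lebesgue (\<Union>i\<in>C. A i)"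
  proof -
    have "emeasure lebesgue P \<le> emeasure lebesgue ((P - (\<Union>i\<in>C. A i)) \<union> (\<Union>i\<in>C. A i))"
      using P C(1) sets by (intro emeasure_mono) (auto intro!: sets.Un sets.Diff sets.countable_UN')
    also have "\<dots> = emeasure lebesgue (\<Union>i\<in>C. A i)"
      using neg C(1) sets
      by (intro emeasure_Un_null_set[of _ _ "_"] | subst Un_commute)+ (auto simp: negligible_iff_null_sets)
    finally show ?thesis .
  qed
  then have "ennreal q * emeasure lebesgue P \<le> ennreal q * emeasure lebesgue (\<Union>i\<in>C. A i)"
    by (intro mult_left_mono) auto
  also have "\<dots> = ennreal q * (\<integral>\<^sup>+i. emeasure lebesgue (A i) \<partial>count_space C)"
    using C(1) sets disjA by (subst emeasure_UN_countable) auto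
  also have "\<dots> = (\<integral>\<^sup>+i. emeasure lebesgue (H i) \<partial>count_space C)"
    by (subst nn_integral_cmult[symmetric]) (auto intro!: nn_integral_cong simp: vol)
  also have "\<dots> = emeasure lebesgue (\<Union>i\<in>C. H i)"
    using C(1) sets disjH by (subst emeasure_UN_countable) auto
  also have "\<dots> \<le> emeasure lebesgue (T - P)"
  proof (rule emeasure_mono)
    show "(\<Union>i\<in>C. H i) \<subseteq> T - P" using HA by fast
  qed (use \<open>T - P \<in> lmeasurable\<close> in auto)
  also note small
  finally show False
    using P \<open>q > 0\<close> by (simp add: emeasure_eq_measure2 ennreal_mult''[symmetric])
qed

section \<open>Geometry of a single uniform domain\<close>

text \<open>A ball that is centred in the closure and avoids the frontier is connected and meets
\<open>S\<close>, hence stays in \<open>S\<close>. The formulation also covers \<open>S =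
UNIV\<close>, and \<open>\<rho> \<le> 0\<close>, where the ball is empty.\<close>

lemma le_infdist_frontier_iff_ball_subset:
  fixes S :: "'a::real_normed_vector set"
  assumes "open S" "x \<in> closure S"
  shows "(frontier S \<noteq> {} \<longrightarrow> \<rho> \<le> infdist x (frontier S)) \<longleftrightarrow> ball x \<rho> \<subseteq> S"
proof
  assume far: "frontier S \<noteq> {} \<longrightarrow> \<rho> \<le> infdist x (frontier S)"
  show "ball x \<rho> \<subseteq> S"
  proof (cases "\<rho> > 0")
    case True
    have "ball x \<rho> \<inter> frontier S = {}"
    proof (rule ccontr)
      assume "ball x \<rho> \<inter> frontier S \<noteq> {}"
      then obtain y where "y \<in> frontier S" "dist x y < \<rho>" by auto
      then show False using far infdist_le[of y "frontier S" x] by auto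
    qed
    moreover have "ball x \<rho> \<inter> S \<noteq> {}"
    proof -
      obtain y where "y \<in> S" "dist y x < \<rho>"
        using \<open>x \<in> closure S\<close> True closure_approachable by blast
      then show ?thesis by (auto simp: dist_commute)
    qed
    ultimately show ?thesis
      using connected_Int_frontier[OF connected_ball[of x \<rho>], of S] by blast
  next
    case False
    then have "ball x \<rho> = {}" by simp
    then show ?thesis by blast
  qed
next
  assume sub: "ball x \<rho> \<subseteq> S"
  show "frontier S \<noteq> {} \<longrightarrow> \<rho> \<le> infdist x (frontier S)"
  proof
    assume "frontier S \<noteq> {}"
    moreover have "\<rho> \<le> dist x y" if "y \<in> frontier S" for y
    proof -
      have "y \<notin> S" using that \<open>open S\<close> by (simp add: frontier_def interior_open)
      then show ?thesis using sub by (auto simp: not_less[symmetric])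
    qed
    ultimately show "\<rho> \<le> infdist x (frontier S)"
      by (auto simp: infdist_def intro: cINF_greatest)
  qed
qed

text \<open>Inclusions of balls need no case distinction on an empty frontier, and they pass to limits of
domains more easily than distances to the frontiers.\<close>

lemma uniform_domain_iff_balls:
  "uniform_domain M S \<longleftrightarrow>
     is_domain S \<and>
     (\<forall>x1 \<in> closure S. \<forall>x2 \<in> closure S. \<exists>\<gamma>.
        rectifiable_curve \<gamma> \<and> path_image \<gamma> \<subseteq> closure S \<and> \<gamma> 0 = x1 \<and> \<gamma> 1 = x2 \<and>
        hausdorff1 (path_image \<gamma>) \<le> ennreal (M * dist x1 x2) \<and>
        (\<forall>t \<in> {0..1}. ball (\<gamma> t) (1 / M * min (dist (\<gamma> t) x1) (dist (\<gamma> t) x2)) \<subseteq> S))"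
proof (cases "open S")
  case True
  have *: "(\<forall>t \<in> {0..1}. frontier S \<noteq> {} \<longrightarrow>
           infdist (\<gamma> t) (frontier S) \<ge> 1 / M * min (dist (\<gamma> t) x1) (dist (\<gamma> t) x2)) \<longleftrightarrow>
        (\<forall>t \<in> {0..1}. ball (\<gamma> t) (1 / M * min (dist (\<gamma> t) x1) (dist (\<gamma> t) x2)) \<subseteq> S)"
    if "path_image \<gamma> \<subseteq> closure S" for \<gamma> x1 x2
  proof (rule ball_cong[OF refl])
    fix t :: real assume "t \<in> {0..1}"
    then have "\<gamma> t \<in> closure S" using that by (auto simp: path_image_def)
    then show "(frontier S \<noteq> {} \<longrightarrow>
           infdist (\<gamma> t) (frontier S) \<ge> 1 / M * min (dist (\<gamma> t) x1) (dist (\<gamma> t) x2)) \<longleftrightarrow>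
        ball (\<gamma> t) (1 / M * min (dist (\<gamma> t) x1) (dist (\<gamma> t) x2)) \<subseteq> S"
      by (rule le_infdist_frontier_iff_ball_subset[OF True])
  qed
  show ?thesis
    unfolding uniform_domain_def by (simp only: * cong: conj_cong)
qed (simp add: uniform_domain_def is_domain_def)

text \<open>The point \<open>z\<close> is where the curve from \<open>x\<close> to \<open>y\<close> meets
the sphere of radius \<open>r\<close> about \<open>x\<close>; there the distance to
\<open>y\<close> is still at least \<open>r\<close>.\<close>

lemma uniform_domain_corkscrew:
  assumes S: "uniform_domain M S" and "x \<in> closure S" "y \<in> closure S"
    and r: "0 \<le> r" "2 * r \<le> dist x y" and "M > 0"
  obtains z where "dist z x = r" "ball z (r / M) \<subseteq> S"
proof -
  obtain \<gamma> where \<gamma>: "path \<gamma>" "\<gamma> 0 = x" "\<gamma> 1 = y"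
    "\<And>t. t \<in> {0..1} \<Longrightarrow> ball (\<gamma> t) (1 / M * min (dist (\<gamma> t) x) (dist (\<gamma> t) y)) \<subseteq> S"
    using assms unfolding uniform_domain_iff_balls rectifiable_curve_def by blast
  have "continuous_on {0..1} (\<lambda>t. dist (\<gamma> t) x)"
    using \<gamma>(1) by (auto simp: path_def intro!: continuous_intros)
  moreover have "dist (\<gamma> 1) x \<ge> r" using r \<gamma>(3) by (simp add: dist_commute)
  ultimately obtain t where t: "t \<in> {0..1}" "dist (\<gamma> t) x = r"
    using IVT'[of "\<lambda>t. dist (\<gamma> t) x" 0 r 1] \<gamma>(2) r by auto
  have "r \<le> dist (\<gamma> t) y"
    using dist_triangle[of x y "\<gamma> t"] t(2) r by (simp add: dist_commute)
  then show thesis using \<gamma>(4)[OF t(1)] t(2) by (intro that[of "\<gamma> t"]) auto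
qed

text \<open>The balls given by \<open>uniform_domain_corkscrew\<close> at small scales lie in the open set
\<open>S\<close>, so they avoid the frontier and make it porous.\<close>

lemma negligible_frontier_uniform_domain:
  assumes S: "uniform_domain M S" and "bounded S" and "M > 1"
  shows "negligible (frontier S)"
proof (rule negligible_porous[where c = "1 / M"])
  show "frontier S \<in> lmeasurable"
    using \<open>bounded S\<close> by (intro lmeasurable_compact compact_frontier_bounded)
  fix x and \<delta> :: real assume x: "x \<in> frontier S" and "\<delta> > 0"
  have "open S" "S \<noteq> {}" using S by (auto simp: uniform_domain_def is_domain_def)
  then obtain y where y: "y \<in> S" by auto
  then have "dist x y > 0"
    using x \<open>open S\<close> by (auto simp: frontier_def interior_open)
  define r where "r = min \<delta> (dist x y) / 2"
  have r: "0 < r" "r < \<delta>" "2 * r \<le> dist x y"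
    using \<open>dist x y > 0\<close> \<open>\<delta> > 0\<close> by (auto simp: r_def)
  obtain z where z: "dist z x = r" "ball z (r / M) \<subseteq> S"
    using uniform_domain_corkscrew[OF S _ _ less_imp_le[OF r(1)] r(3)] x y \<open>M > 1\<close> closure_subset
    by (auto simp: frontier_def)
  moreover have "S \<inter> frontier S = {}" using \<open>open S\<close> by (auto simp: frontier_def interior_open)
  ultimately have "ball z (1 / M * r) \<inter> frontier S = {}" by auto
  then show "\<exists>r z. 0 < r \<and> r < \<delta> \<and> dist z x \<le> r \<and> ball z (1 / M * r) \<inter> frontier S = {}"
    using r z by (intro exI[of _ r] exI[of _ z]) auto
qed (use \<open>M > 1\<close> in auto)

section \<open>Limits of uniform domains\<close>

text \<open>The setting after passage to a subsequence: the distance functions to the complements converge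
everywhere. For unbounded \<open>\<Omega> i\<close> these distances could be 0 by convention,
because of an empty complement; the common ball excludes this.\<close>

locale uniform_domain_sequence =
  fixes M R d :: real and \<Omega> :: "nat \<Rightarrow> (real ^ 'n) set" and f :: "real ^ 'n \<Rightarrow> real"
  assumes M: "M > 1" and d: "d > 0"
    and uniform: "\<And>i. uniform_domain M (\<Omega> i)"
    and in_ball: "\<And>i. \<Omega> i \<subseteq> ball 0 R"
    and diam: "\<And>i. d \<le> diameter (\<Omega> i)"
    and lim: "\<And>x. (\<lambda>i. infdist x (- \<Omega> i)) \<longlonglongrightarrow> f x"
begin

definition limit_domain :: "(real ^ 'n) set" where
  "limit_domain = {x. f x > 0}"

lemma domain: "open (\<Omega> i)" "connected (\<Omega> i)" "\<Omega> i \<noteq> {}"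
  using uniform[of i] by (auto simp: uniform_domain_def is_domain_def)

lemma bounded_domain: "bounded (\<Omega> i)"
  using in_ball bounded_ball bounded_subset by blast

lemma compl_nonempty: "- \<Omega> i \<noteq> {}"
  using bounded_domain[of i] not_bounded_UNIV by (metis Compl_empty_eq double_complement)

lemma le_infdist_compl_iff: "\<rho> \<le> infdist x (- \<Omega> i) \<longleftrightarrow> ball x \<rho> \<subseteq> \<Omega> i"
proof
  assume "\<rho> \<le> infdist x (- \<Omega> i)"
  then show "ball x \<rho> \<subseteq> \<Omega> i"
    using infdist_le[of _ "- \<Omega> i" x] by fastforce
next
  assume sub: "ball x \<rho> \<subseteq> \<Omega> i"
  have "\<rho> \<le> dist x y" if "y \<in> - \<Omega> i" for y
    using sub that by (auto simp: not_less[symmetric])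
  then show "\<rho> \<le> infdist x (- \<Omega> i)"
    using compl_nonempty by (auto simp: infdist_def intro: cINF_greatest)
qed

lemma f_nonneg: "0 \<le> f x"
  by (rule tendsto_lowerbound[OF lim]) (auto simp: infdist_nonneg)

lemma f_Lipschitz: "\<bar>f x - f y\<bar> \<le> dist x y"
  by (rule tendsto_upperbound[OF tendsto_rabs[OF tendsto_diff[OF lim lim]]])
     (auto simp: infdist_triangle_abs)

lemma f_le_dist_compl: "y \<notin> limit_domain \<Longrightarrow> f x \<le> dist x y"
  using f_Lipschitz[of x y] f_nonneg[of y] by (auto simp: limit_domain_def)

lemma ball_subset_limit_domain: "\<rho> \<le> f x \<Longrightarrow> ball x \<rho> \<subseteq> limit_domain"
  using f_le_dist_compl[of _ x] by (force simp: subset_iff)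

lemma open_limit_domain: "open limit_domain"
proof -
  have "1-lipschitz_on UNIV f"
    using f_Lipschitz by (auto simp: lipschitz_on_def dist_real_def)
  then show ?thesis
    unfolding limit_domain_def
    using lipschitz_on_continuous_on by (intro open_Collect_less continuous_intros) auto
qed

text \<open>The distance functions are 1-Lipschitz uniformly in \<open>i\<close>, so the point of evaluation
may move along with the domain.\<close>

lemma lim_moving:
  assumes r: "strict_mono (r :: nat \<Rightarrow> nat)" and y: "y \<longlonglongrightarrow> x"
  shows "(\<lambda>k. infdist (y k) (- \<Omega> (r k))) \<longlonglongrightarrow> f x"
proof -
  have "(\<lambda>k. infdist (y k) (- \<Omega> (r k)) - infdist x (- \<Omega> (r k))) \<longlonglongrightarrow> 0"
  proof (rule Lim_null_comparison)
    show "\<forall>\<^sub>F k in sequentially.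
            norm (infdist (y k) (- \<Omega> (r k)) - infdist x (- \<Omega> (r k))) \<le> dist (y k) x"
      by (simp add: infdist_triangle_abs)
    show "(\<lambda>k. dist (y k) x) \<longlonglongrightarrow> 0"
      using y by (rule tendsto_dist_iff[THEN iffD1])
  qed
  moreover have "(\<lambda>k. infdist x (- \<Omega> (r k))) \<longlonglongrightarrow> f x"
    using LIMSEQ_subseq_LIMSEQ[OF lim r] by (simp add: o_def)
  ultimately show ?thesis
    using tendsto_add by fastforce
qed

lemma le_f_of_balls:
  assumes r: "strict_mono (r :: nat \<Rightarrow> nat)" and y: "y \<longlonglongrightarrow> x" and "\<rho> \<longlonglongrightarrow> \<rho>'"
    and "\<And>k. ball (y k) (\<rho> k) \<subseteq> \<Omega> (r k)"
  shows "\<rho>' \<le> f x"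
  using assms by (intro LIMSEQ_le[OF assms(3) lim_moving[OF r y]]) (auto simp: le_infdist_compl_iff)

lemma eventually_in_domain:
  assumes "x \<in> limit_domain"
  shows "\<forall>\<^sub>F i in sequentially. x \<in> \<Omega> i"
proof -
  have "\<forall>\<^sub>F i in sequentially. 0 < infdist x (- \<Omega> i)"
    using assms lim by (intro order_tendstoD) (auto simp: limit_domain_def)
  then show ?thesis
    by eventually_elim (metis ComplI infdist_zero less_irrefl)
qed

lemma corkscrew:
  assumes "x \<in> closure (\<Omega> i)" "0 < \<rho>" "\<rho> \<le> d / 8"
  obtains z where "dist z x = \<rho>" "ball z (\<rho> / M) \<subseteq> \<Omega> i"
proof -
  have "d / 2 < diameter (\<Omega> i)" using diam[of i] d by linarith
  then obtain a b where ab: "a \<in> \<Omega> i" "b \<in> \<Omega> i" "d / 2 < dist a b"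
    using diameter_lower_bounded[OF bounded_domain] d by (metis half_gt_zero)
  have "2 * \<rho> \<le> dist x a \<or> 2 * \<rho> \<le> dist x b"
    using ab(3) dist_triangle[of a b x] assms(3) by (auto simp: dist_commute)
  then obtain y where y: "y \<in> closure (\<Omega> i)" "2 * \<rho> \<le> dist x y"
    using ab closure_subset by blast
  show thesis
    using uniform_domain_corkscrew[OF uniform assms(1) y(1) less_imp_le[OF assms(2)] y(2)] M that by auto
qed

text \<open>The balls of radius \<open>\<rho> / M\<close> at distance \<open>\<rho>\<close> from \<open>y
k\<close> have a radius that does not depend on \<open>k\<close>. Hence a cluster point of their
centres belongs to the limit domain, at distance \<open>\<rho>\<close> from \<open>x\<close>.
Without such balls, thin parts of the domains could vanish from the limit domain while their
points still accumulate away from it.\<close>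

lemma limit_in_closure:
  assumes r: "strict_mono (r :: nat \<Rightarrow> nat)" and y: "y \<longlonglongrightarrow> x"
    and mem: "\<And>k. y k \<in> closure (\<Omega> (r k))"
  shows "x \<in> closure limit_domain"
  unfolding closure_approachable
proof (intro allI impI)
  fix e :: real assume "e > 0"
  define \<rho> where "\<rho> = min (e / 2) (d / 8)"
  have \<rho>: "0 < \<rho>" "\<rho> \<le> d / 8" "\<rho> < e" using \<open>e > 0\<close> d by (auto simp: \<rho>_def)
  have "\<forall>k. \<exists>z. dist z (y k) = \<rho> \<and> ball z (\<rho> / M) \<subseteq> \<Omega> (r k)"
    using corkscrew[OF mem \<rho>(1,2)] by metis
  then obtain z where z: "\<And>k. dist (z k) (y k) = \<rho>" "\<And>k. ball (z k) (\<rho> / M) \<subseteq> \<Omega> (r k)"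
    by metis
  have "z k \<in> cball 0 R" for k
  proof -
    have "z k \<in> ball (z k) (\<rho> / M)" using \<rho> M by simp
    then have "z k \<in> ball 0 R" using z(2)[of k] in_ball[of "r k"] by blast
    then show ?thesis by simp
  qed
  then obtain w u where u: "strict_mono (u :: nat \<Rightarrow> nat)" "(z \<circ> u) \<longlonglongrightarrow> w"
    using compact_cball[of "0 :: real ^ 'n" R] unfolding compact_eq_seq_compact_metric seq_compact_def
    by metis
  have "\<rho> / M \<le> f w"
    using z(2) by (intro le_f_of_balls[OF strict_mono_o[OF r u(1)] u(2) tendsto_const]) auto
  moreover have "0 < \<rho> / M" using \<rho>(1) M by simp
  ultimately have "w \<in> limit_domain"
    unfolding limit_domain_def mem_Collect_eq by linarith
  moreover have "dist w x = \<rho>"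
  proof (rule LIMSEQ_unique)
    show "(\<lambda>k. dist (z (u k)) (y (u k))) \<longlonglongrightarrow> dist w x"
      using u(2) LIMSEQ_subseq_LIMSEQ[OF y u(1)] by (intro tendsto_dist) (simp_all add: o_def)
  qed (simp add: z)
  ultimately show "\<exists>w\<in>limit_domain. dist w x < e" using \<rho> by auto
qed

lemma limit_domain_nonempty: "limit_domain \<noteq> {}"
proof -
  have "\<forall>i. \<exists>y. y \<in> \<Omega> i" using domain(3) by blast
  then obtain y where y: "\<And>i. y i \<in> \<Omega> i" by metis
  then have "y i \<in> cball 0 R" for i using in_ball[of i] ball_subset_cball by blast
  then obtain w u where u: "strict_mono (u :: nat \<Rightarrow> nat)" "(y \<circ> u) \<longlonglongrightarrow> w"
    using compact_cball[of "0 :: real ^ 'n" R] unfolding compact_eq_seq_compact_metric seq_compact_def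
    by metis
  have "w \<in> closure limit_domain"
    using y closure_subset by (intro limit_in_closure[OF u]) auto
  then show ?thesis by auto
qed

lemma limit_domain_in_ball: "limit_domain \<subseteq> ball 0 R"
proof
  fix x assume "x \<in> limit_domain"
  then obtain i where "x \<in> \<Omega> i"
    using eventually_in_domain[of x] by (auto simp: eventually_sequentially)
  then show "x \<in> ball 0 R" using in_ball by blast
qed

lemma approximating_points:
  assumes x: "x \<in> closure limit_domain"
  obtains a where "\<And>i. a i \<in> \<Omega> i" "a \<longlonglongrightarrow> x"
proof -
  have "\<exists>b\<in>\<Omega> i. dist x b < infdist x (\<Omega> i) + inverse (real (Suc i))" for i
  proof (rule ccontr)
    assume "\<not> ?thesis"
    then have far: "infdist x (\<Omega> i) + inverse (real (Suc i)) \<le> dist x b" if "b \<in> \<Omega> i" for b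
      using that not_less by blast
    have "infdist x (\<Omega> i) + inverse (real (Suc i)) \<le> (INF b\<in>\<Omega> i. dist x b)"
      using domain(3)[of i] far by (rule cINF_greatest)
    moreover have "(INF b\<in>\<Omega> i. dist x b) = infdist x (\<Omega> i)"
      using domain(3)[of i] by (simp add: infdist_def)
    moreover have "0 < inverse (real (Suc i))" by simp
    ultimately show False by linarith
  qed
  then obtain a where a: "\<And>i. a i \<in> \<Omega> i"
    "\<And>i. dist x (a i) < infdist x (\<Omega> i) + inverse (real (Suc i))"
    by metis
  have inf0: "(\<lambda>i. infdist x (\<Omega> i)) \<longlonglongrightarrow> 0"
  proof (rule order_tendstoI)
    fix e :: real assume "0 < e"
    then obtain y where y: "y \<in> limit_domain" "dist y x < e"
      using x closure_approachable by blast
    show "\<forall>\<^sub>F i in sequentially. infdist x (\<Omega> i) < e"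
      using eventually_in_domain[OF y(1)]
    proof eventually_elim
      case (elim i)
      then show ?case using infdist_le[of y "\<Omega> i" x] y(2) by (simp add: dist_commute)
    qed
  next
    fix e :: real assume "e < 0"
    then show "\<forall>\<^sub>F i in sequentially. e < infdist x (\<Omega> i)"
      using infdist_nonneg[of x] less_le_trans by (intro always_eventually) blast
  qed
  have "(\<lambda>i. dist (a i) x) \<longlonglongrightarrow> 0"
  proof (rule tendsto_sandwich[OF _ _ tendsto_const])
    show "\<forall>\<^sub>F i in sequentially. dist (a i) x \<le> infdist x (\<Omega> i) + inverse (real (Suc i))"
      using a(2) by (intro always_eventually) (auto simp: dist_commute intro: less_imp_le)
    show "(\<lambda>i. infdist x (\<Omega> i) + inverse (real (Suc i))) \<longlonglongrightarrow> 0"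
      using tendsto_add[OF inf0 LIMSEQ_inverse_real_of_nat] by simp
  qed simp
  then have "a \<longlonglongrightarrow> x" by (rule tendsto_dist_iff[THEN iffD2])
  with a(1) show thesis by (rule that)
qed

text \<open>Discretised curves between points \<open>a i\<close> and \<open>b i\<close> of \<open>\<Omega>
i\<close> that approximate \<open>x1\<close> and \<open>x2\<close> converge pointwise along a
subsequence. All properties in question are closed under pointwise convergence.\<close>

lemma limit_curve:
  assumes x1: "x1 \<in> closure limit_domain" and x2: "x2 \<in> closure limit_domain"
  obtains \<gamma> :: "real \<Rightarrow> real ^ 'n" where "\<gamma> 0 = x1" "\<gamma> 1 = x2"
    "\<And>s t. s \<in> {0..1} \<Longrightarrow> t \<in> {0..1} \<Longrightarrow> dist (\<gamma> s) (\<gamma> t) \<le> M * dist x1 x2 * dist s t"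
    "path_image \<gamma> \<subseteq> closure limit_domain"
    "\<And>t. t \<in> {0..1} \<Longrightarrow> 1 / M * min (dist (\<gamma> t) x1) (dist (\<gamma> t) x2) \<le> f (\<gamma> t)"
proof -
  obtain a where a: "\<And>i. a i \<in> \<Omega> i" "a \<longlonglongrightarrow> x1" using approximating_points[OF x1] by blast
  obtain b where b: "\<And>i. b i \<in> \<Omega> i" "b \<longlonglongrightarrow> x2" using approximating_points[OF x2] by blast
  define \<epsilon> where "\<epsilon> i = inverse (real (Suc i))" for i
  have \<epsilon>: "\<epsilon> \<longlonglongrightarrow> 0" "\<epsilon> i > 0" for i
    unfolding \<epsilon>_def by (rule LIMSEQ_inverse_real_of_nat) simp
  have "\<exists>g :: real \<Rightarrow> real ^ 'n. g 0 = a i \<and> g 1 = b i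
      \<and> (\<forall>s\<in>{0..1}. \<forall>t\<in>{0..1}. dist (g s) (g t) \<le> M * dist (a i) (b i) * dist s t + \<epsilon> i)
      \<and> (\<forall>t. g t \<in> closure (\<Omega> i) \<and> ball (g t) (1 / M * min (dist (g t) (a i)) (dist (g t) (b i))) \<subseteq> \<Omega> i)"
    (is "\<exists>g. ?Q i g") for i
  proof -
    have "a i \<in> closure (\<Omega> i)" "b i \<in> closure (\<Omega> i)" using a b closure_subset by blast+
    then obtain p where p: "path p" "path_image p \<subseteq> closure (\<Omega> i)" "p 0 = a i" "p 1 = b i"
      "hausdorff1 (path_image p) \<le> ennreal (M * dist (a i) (b i))"
      "\<And>t. t \<in> {0..1} \<Longrightarrow> ball (p t) (1 / M * min (dist (p t) (a i)) (dist (p t) (b i))) \<subseteq> \<Omega> i"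
      using uniform[of i] unfolding uniform_domain_iff_balls rectifiable_curve_def by blast
    have "0 \<le> M * dist (a i) (b i)" using M by simp
    then obtain g :: "real \<Rightarrow> real ^ 'n" where g: "g 0 = p 0" "g 1 = p 1" "range g \<subseteq> path_image p"
      "\<And>s t. s \<in> {0..1} \<Longrightarrow> t \<in> {0..1} \<Longrightarrow> dist (g s) (g t) \<le> M * dist (a i) (b i) * dist s t + \<epsilon> i"
      by (rule path_discretization[OF p(1,5) _ \<epsilon>(2)[of i]]) blast
    have "g t \<in> closure (\<Omega> i) \<and> ball (g t) (1 / M * min (dist (g t) (a i)) (dist (g t) (b i))) \<subseteq> \<Omega> i" for t
    proof -
      have "g t \<in> path_image p" using g(3) by blast
      then obtain s where "s \<in> {0..1}" "g t = p s" by (auto simp: path_image_def)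
      then show ?thesis using p(2) p(6)[of s] \<open>g t \<in> path_image p\<close> by auto
    qed
    then show ?thesis using g p(3,4) by (intro exI[of _ g]) auto
  qed
  then obtain g where g: "\<And>i. ?Q i (g i)" by metis
  have g0: "g i 0 = a i" and g1: "g i 1 = b i"
    and glip: "s \<in> {0..1} \<Longrightarrow> t \<in> {0..1} \<Longrightarrow> dist (g i s) (g i t) \<le> M * dist (a i) (b i) * dist s t + \<epsilon> i"
    and gcl: "g i t \<in> closure (\<Omega> i)"
    and gball: "ball (g i t) (1 / M * min (dist (g i t) (a i)) (dist (g i t) (b i))) \<subseteq> \<Omega> i" for i s t
    using g[of i] by blast+
  have abd: "dist (a i) (b i) \<le> 2 * R" for i
  proof -
    have "norm (a i) < R" "norm (b i) < R" using a(1)[of i] b(1)[of i] in_ball[of i] by auto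
    then show ?thesis using dist_triangle[of "a i" "b i" 0] by simp
  qed
  obtain r \<gamma> where r: "strict_mono (r :: nat \<Rightarrow> nat)"
    and \<gamma>: "\<And>t. t \<in> {0..1::real} \<Longrightarrow> (\<lambda>k. g (r k) t) \<longlonglongrightarrow> \<gamma> t"
  proof (rule asymptotically_Lipschitz_convergent_subsequence[of "{0..1::real}" g R "M * (2 * R)" \<epsilon>])
    fix i t
    have "closure (\<Omega> i) \<subseteq> cball 0 R"
      using in_ball[of i] ball_subset_cball by (intro closure_minimal) auto
    then show "norm (g i t) \<le> R" using gcl[of i t] by auto
  next
    fix i and s t :: real assume st: "s \<in> {0..1}" "t \<in> {0..1}"
    have "M * dist (a i) (b i) * dist s t \<le> M * (2 * R) * dist s t"
      using M abd by (intro mult_right_mono mult_left_mono) auto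
    then show "dist (g i s) (g i t) \<le> M * (2 * R) * dist s t + \<epsilon> i"
      using glip[OF st, of i] by linarith
  qed (use \<epsilon> that in auto)
  have ar: "(\<lambda>k. a (r k)) \<longlonglongrightarrow> x1" and br: "(\<lambda>k. b (r k)) \<longlonglongrightarrow> x2" and \<epsilon>r: "(\<lambda>k. \<epsilon> (r k)) \<longlonglongrightarrow> 0"
    using LIMSEQ_subseq_LIMSEQ[OF a(2) r] LIMSEQ_subseq_LIMSEQ[OF b(2) r] LIMSEQ_subseq_LIMSEQ[OF \<epsilon>(1) r]
    by (simp_all add: o_def)
  show thesis
  proof (rule that)
    show "\<gamma> 0 = x1" using LIMSEQ_unique[OF \<gamma>[of 0]] ar by (simp add: g0)
    show "\<gamma> 1 = x2" using LIMSEQ_unique[OF \<gamma>[of 1]] br by (simp add: g1)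
  next
    fix s t :: real assume st: "s \<in> {0..1}" "t \<in> {0..1}"
    have "dist (\<gamma> s) (\<gamma> t) \<le> M * dist x1 x2 * dist s t + 0"
    proof (rule LIMSEQ_le)
      show "(\<lambda>k. dist (g (r k) s) (g (r k) t)) \<longlonglongrightarrow> dist (\<gamma> s) (\<gamma> t)"
        using \<gamma> st by (intro tendsto_dist)
      show "(\<lambda>k. M * dist (a (r k)) (b (r k)) * dist s t + \<epsilon> (r k)) \<longlonglongrightarrow> M * dist x1 x2 * dist s t + 0"
        by (intro tendsto_intros ar br \<epsilon>r)
    qed (use glip st in auto)
    then show "dist (\<gamma> s) (\<gamma> t) \<le> M * dist x1 x2 * dist s t" by simp
  next
    show "path_image \<gamma> \<subseteq> closure limit_domain"
      using limit_in_closure[OF r \<gamma>] gcl by (auto simp: path_image_def)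
  next
    fix t :: real assume t: "t \<in> {0..1}"
    show "1 / M * min (dist (\<gamma> t) x1) (dist (\<gamma> t) x2) \<le> f (\<gamma> t)"
    proof (rule le_f_of_balls[OF r \<gamma>[OF t]])
      show "(\<lambda>k. 1 / M * min (dist (g (r k) t) (a (r k))) (dist (g (r k) t) (b (r k))))
              \<longlonglongrightarrow> 1 / M * min (dist (\<gamma> t) x1) (dist (\<gamma> t) x2)"
        by (intro tendsto_mult_left tendsto_min tendsto_dist \<gamma>[OF t] ar br)
    qed (rule gball)
  qed
qed

text \<open>By the distance condition \<open>f\<close> is positive along a limit curve, except possibly
where it passes through an endpoint, and the endpoints are in the limit domain anyway.\<close>

lemma connected_limit_domain: "connected limit_domain"
proof -
  have "\<exists>\<gamma>. path \<gamma> \<and> path_image \<gamma> \<subseteq> limit_domain \<and> pathstart \<gamma> = x1 \<and> pathfinish \<gamma> = x2"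
    if x: "x1 \<in> limit_domain" "x2 \<in> limit_domain" for x1 x2
  proof -
    have "x1 \<in> closure limit_domain" "x2 \<in> closure limit_domain" using x closure_subset by blast+
    then obtain \<gamma> :: "real \<Rightarrow> real ^ 'n" where \<gamma>: "\<gamma> 0 = x1" "\<gamma> 1 = x2"
      "\<And>s t. s \<in> {0..1} \<Longrightarrow> t \<in> {0..1} \<Longrightarrow> dist (\<gamma> s) (\<gamma> t) \<le> M * dist x1 x2 * dist s t"
      "\<And>t. t \<in> {0..1} \<Longrightarrow> 1 / M * min (dist (\<gamma> t) x1) (dist (\<gamma> t) x2) \<le> f (\<gamma> t)"
      by (rule limit_curve) blast
    have "path \<gamma>"
      using Lipschitz_curve_length(1)[of \<gamma> "M * dist x1 x2"] \<gamma>(3) M by (simp add: rectifiable_curve_def)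
    moreover have "\<gamma> t \<in> limit_domain" if "t \<in> {0..1}" for t
    proof (cases "\<gamma> t = x1 \<or> \<gamma> t = x2")
      case False
      then have "0 < 1 / M * min (dist (\<gamma> t) x1) (dist (\<gamma> t) x2)" using M by simp
      then show ?thesis using \<gamma>(4)[OF that] by (simp add: limit_domain_def)
    qed (use x in auto)
    ultimately show ?thesis
      using \<gamma>(1,2) by (intro exI[of _ \<gamma>]) (auto simp: path_image_def pathstart_def pathfinish_def)
  qed
  then have "path_connected limit_domain" unfolding path_connected_def by blast
  then show ?thesis by (rule path_connected_imp_connected)
qed

lemma uniform_limit_domain: "uniform_domain M limit_domain"
  unfolding uniform_domain_iff_balls
proof (intro conjI ballI)
  show "is_domain limit_domain"
    using limit_domain_nonempty open_limit_domain connected_limit_domain by (simp add: is_domain_def)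
  fix x1 x2 assume x: "x1 \<in> closure limit_domain" "x2 \<in> closure limit_domain"
  obtain \<gamma> where \<gamma>: "\<gamma> 0 = x1" "\<gamma> 1 = x2"
    "\<And>s t. s \<in> {0..1} \<Longrightarrow> t \<in> {0..1} \<Longrightarrow> dist (\<gamma> s) (\<gamma> t) \<le> M * dist x1 x2 * dist s t"
    "path_image \<gamma> \<subseteq> closure limit_domain"
    "\<And>t. t \<in> {0..1} \<Longrightarrow> 1 / M * min (dist (\<gamma> t) x1) (dist (\<gamma> t) x2) \<le> f (\<gamma> t)"
    by (rule limit_curve[OF x]) blast
  have "0 \<le> M * dist x1 x2" using M by simp
  note len = Lipschitz_curve_length[OF \<gamma>(3) this]
  show "\<exists>\<gamma>. rectifiable_curve \<gamma> \<and> path_image \<gamma> \<subseteq> closure limit_domain \<and> \<gamma> 0 = x1 \<and> \<gamma> 1 = x2 \<and>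
        hausdorff1 (path_image \<gamma>) \<le> ennreal (M * dist x1 x2) \<and>
        (\<forall>t \<in> {0..1}. ball (\<gamma> t) (1 / M * min (dist (\<gamma> t) x1) (dist (\<gamma> t) x2)) \<subseteq> limit_domain)"
    using len \<gamma>(1,2,4) ball_subset_limit_domain[OF \<gamma>(5)] by (intro exI[of _ \<gamma>]) blast
qed

text \<open>The sets \<open>E n\<close> decrease to the set of points that lie in infinitely many symmetric
differences. A point of the limit domain is eventually in \<open>\<Omega> i\<close>, and a point
in infinitely many \<open>\<Omega> i\<close> is in the closure of the limit domain, so only
points of the null set \<open>frontier limit_domain\<close> remain.\<close>

lemma tendsto_measure_sym_diff:
  "(\<lambda>i. emeasure lebesgue (sym_diff (\<Omega> i) limit_domain)) \<longlonglongrightarrow> 0"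
proof -
  define E where "E n = (\<Union>i\<in>{n..}. sym_diff (\<Omega> i) limit_domain)" for n
  have D: "sym_diff (\<Omega> i) limit_domain \<in> sets lebesgue" for i
    using domain(1)[of i] open_limit_domain by (intro sets.Un sets.Diff) auto
  then have E: "E n \<in> sets lebesgue" for n
    unfolding E_def by (intro sets.countable_UN') auto
  have "E n \<subseteq> ball 0 R" for n
    using in_ball limit_domain_in_ball by (fastforce simp: E_def)
  then have fin: "emeasure lebesgue (E n) \<noteq> \<infinity>" for n
    using emeasure_mono[of "E n" "ball 0 R" lebesgue] emeasure_lborel_ball_finite[of "0 :: real ^ 'n" R]
    by (auto simp: top_unique)
  have "(\<Inter>n. E n) \<subseteq> frontier limit_domain"
  proof
    fix x assume "x \<in> (\<Inter>n. E n)"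
    then have inf: "\<exists>\<^sub>F i in sequentially. x \<in> sym_diff (\<Omega> i) limit_domain"
      by (auto simp: E_def frequently_sequentially)
    have out: "x \<notin> limit_domain"
    proof
      assume x: "x \<in> limit_domain"
      then have "\<forall>\<^sub>F i in sequentially. x \<notin> sym_diff (\<Omega> i) limit_domain"
        using eventually_in_domain[OF x] by (auto elim: eventually_mono)
      then show False using inf by (simp add: frequently_def)
    qed
    then have "\<exists>\<^sub>F i in sequentially. x \<in> \<Omega> i"
      using inf by (auto elim: frequently_elim1)
    then have "infinite {i. x \<in> \<Omega> i}"
      by (simp add: frequently_cofinite cofinite_eq_sequentially[symmetric])
    then have "strict_mono (enumerate {i. x \<in> \<Omega> i})" "\<And>k. x \<in> \<Omega> (enumerate {i. x \<in> \<Omega> i} k)"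
      using enumerate_in_set[of "{i. x \<in> \<Omega> i}"] by (auto simp: strict_mono_enumerate)
    then have "x \<in> closure limit_domain"
      using closure_subset by (intro limit_in_closure[OF _ tendsto_const]) auto
    then show "x \<in> frontier limit_domain"
      using out open_limit_domain by (simp add: frontier_def interior_open)
  qed
  moreover have "negligible (frontier limit_domain)"
    using negligible_frontier_uniform_domain[OF uniform_limit_domain _ M] limit_domain_in_ball
    by (meson bounded_ball bounded_subset)
  ultimately have "emeasure lebesgue (\<Inter>n. E n) = 0"
    by (meson negligible_iff_emeasure0 negligible_subset negligible_imp_sets)
  moreover have "(\<lambda>n. emeasure lebesgue (E n)) \<longlonglongrightarrow> emeasure lebesgue (\<Inter>n. E n)"
    using E fin by (intro Lim_emeasure_decseq) (force simp: decseq_def E_def)+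
  ultimately have lim_E: "(\<lambda>n. emeasure lebesgue (E n)) \<longlonglongrightarrow> 0" by simp
  show ?thesis
  proof (rule tendsto_sandwich[OF _ _ tendsto_const lim_E])
    show "\<forall>\<^sub>F i in sequentially. emeasure lebesgue (sym_diff (\<Omega> i) limit_domain) \<le> emeasure lebesgue (E i)"
      using E by (intro always_eventually allI emeasure_mono) (auto simp: E_def)
  qed simp
qed

end

section \<open>Compactness\<close>

theorem theorem1p2:
  fixes M R :: real and \<Omega> :: "nat \<Rightarrow> (real ^ 'n) set"
  assumes "M > 1" and "R > 0"
    and "\<And>i. uniform_domain M (\<Omega> i)"
    and "\<And>i. \<Omega> i \<subseteq> ball 0 R"
    and "(INF i. diameter (\<Omega> i)) > 0"
  shows "\<exists>(\<Omega>' :: (real ^ 'n) set) r :: nat \<Rightarrow> nat.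
           uniform_domain M \<Omega>' \<and> strict_mono r \<and>
           (\<lambda>k. emeasure lebesgue (sym_diff (\<Omega> (r k)) \<Omega>')) \<longlonglongrightarrow> 0"
proof -
  have bounded: "bounded (\<Omega> i)" for i using assms(4) bounded_ball bounded_subset by blast
  define F where "F i x = infdist x (- \<Omega> i)" for i x
  \<comment> \<open>a point outside all the domains, which bounds the distances to their complements\<close>
  obtain z :: "real ^ 'n" where z: "norm z = R" using vector_choose_size \<open>R > 0\<close> by (metis less_imp_le)
  have F_bound: "norm (F i x) \<le> 2 * R" for i x
  proof (cases "x \<in> \<Omega> i")
    case True
    have "z \<notin> \<Omega> i" using assms(4)[of i] z by auto
    then have "F i x \<le> dist x z" unfolding F_def by (intro infdist_le) auto
    also have "\<dots> \<le> norm x + norm z" by (simp add: dist_norm norm_triangle_ineq4)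
    also have "\<dots> \<le> 2 * R" using True assms(4)[of i] z by auto
    finally show ?thesis by (simp add: F_def infdist_nonneg)
  next
    case False
    then show ?thesis using \<open>R > 0\<close> by (simp add: F_def)
  qed
  obtain r f where r: "strict_mono (r :: nat \<Rightarrow> nat)" and f: "\<And>x. (\<lambda>k. F (r k) x) \<longlonglongrightarrow> f x"
  proof (rule asymptotically_Lipschitz_convergent_subsequence[of UNIV F "2 * R" 1 "\<lambda>_. 0"])
    show "dist (F i x) (F i y) \<le> 1 * dist x y + 0" for i x y
      by (simp add: F_def dist_real_def infdist_triangle_abs)
  qed (use F_bound that in auto)
  interpret uniform_domain_sequence M R "INF i. diameter (\<Omega> i)" "\<lambda>k. \<Omega> (r k)" f
  proof
    show "(INF i. diameter (\<Omega> i)) \<le> diameter (\<Omega> (r k))" for k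
      using bounded by (intro cINF_lower) (auto intro!: bdd_belowI[of _ 0] diameter_ge_0)
  qed (use assms f in \<open>auto simp: F_def\<close>)
  show ?thesis
    using uniform_limit_domain tendsto_measure_sym_diff r by blast
qed

end
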